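(* For any finite Coxeter group $W$, the biHecke monoid $M(W)$ is acyclic: for any $f\in M(W)$, there exists $k>0$ such that $f^{k+1}=f^k$.
   Context: $W$ is a finite Coxeter group with simple reflections $(s_i)_{i\in I}$ and length $\ell$; $D_R(w)=\{i:\ell(ws_i)<\ell(w)\}$. The biHecke monoid $M(W)$ is the monoid of functions $W\to W$, acting on the right, generated by $\pi_i,\overline\pi_i$ ($i\in I$), where $w.\pi_i=w$ if $i\in D_R(w)$ and $ws_i$ otherwise; $w.\overline\pi_i=ws_i$ if $i\in D_R(w)$ and $w$ otherwise. *)

theory Defs
  imports "HOL-Algebra.Group"
begin

section \<open>Coxeter systems\<close>

fun word_prod :: "('a, 'b) monoid_scheme \<Rightarrow> ('i \<Rightarrow> 'a) \<Rightarrow> 'i list \<Rightarrow> 'a" where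
  "word_prod W s [] = \<one>\<^bsub>W\<^esub>"
| "word_prod W s (i # u) = s i \<otimes>\<^bsub>W\<^esub> word_prod W s u"

text \<open>
  The congruence on words over \<open>I\<close> generated by the Coxeter relations \<open>(i j)^(m i j) = 1\<close>.
  The value \<open>m i j = 0\<close> encodes \<open>m i j = \<infinity>\<close>, i.e. no relation between \<open>i\<close> and \<open>j\<close>.
  Since \<open>m i i = 1\<close> in a Coxeter matrix, the relations include \<open>i i = 1\<close>. Hence the monoid
  presented in this way is already a group, and formal inverses of the letters are not needed.
\<close>

inductive coxeter_equiv :: "'i set \<Rightarrow> ('i \<Rightarrow> 'i \<Rightarrow> nat) \<Rightarrow> 'i list \<Rightarrow> 'i list \<Rightarrow> bool"
  for I :: "'i set" and m :: "'i \<Rightarrow> 'i \<Rightarrow> nat" where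
  refl: "u \<in> lists I \<Longrightarrow> coxeter_equiv I m u u"
| sym: "coxeter_equiv I m u v \<Longrightarrow> coxeter_equiv I m v u"
| trans: "coxeter_equiv I m u v \<Longrightarrow> coxeter_equiv I m v w \<Longrightarrow> coxeter_equiv I m u w"
| relation: "p \<in> lists I \<Longrightarrow> q \<in> lists I \<Longrightarrow> i \<in> I \<Longrightarrow> j \<in> I \<Longrightarrow> m i j > 0
    \<Longrightarrow> coxeter_equiv I m (p @ concat (replicate (m i j) [i, j]) @ q) (p @ q)"

text \<open>
  The assumptions \<open>generated\<close> and \<open>presented\<close> together say that \<open>W\<close> is presented by the
  generators \<open>s i\<close> (\<open>i \<in> I\<close>) subject to the relations \<open>(s i s j)^(m i j) = 1\<close>.
\<close>

locale coxeter_system = group W for W :: "('a, 'b) monoid_scheme" (structure) +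
  fixes I :: "'i set" and m :: "'i \<Rightarrow> 'i \<Rightarrow> nat" and s :: "'i \<Rightarrow> 'a"
  assumes matrix_diag: "i \<in> I \<Longrightarrow> m i i = 1"
    and matrix_off_diag: "i \<in> I \<Longrightarrow> j \<in> I \<Longrightarrow> i \<noteq> j \<Longrightarrow> m i j \<noteq> 1"
    and matrix_sym: "i \<in> I \<Longrightarrow> j \<in> I \<Longrightarrow> m i j = m j i"
    and simple_closed: "i \<in> I \<Longrightarrow> s i \<in> carrier W"
    and generated: "w \<in> carrier W \<Longrightarrow> \<exists>u \<in> lists I. word_prod W s u = w"
    and presented: "u \<in> lists I \<Longrightarrow> v \<in> lists I
      \<Longrightarrow> word_prod W s u = word_prod W s v \<longleftrightarrow> coxeter_equiv I m u v"

definition coxeter_length :: "('a, 'b) monoid_scheme \<Rightarrow> 'i set \<Rightarrow> ('i \<Rightarrow> 'a) \<Rightarrow> 'a \<Rightarrow> nat" where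
  "coxeter_length W I s w = (LEAST n. \<exists>u \<in> lists I. length u = n \<and> word_prod W s u = w)"

definition right_descents :: "('a, 'b) monoid_scheme \<Rightarrow> 'i set \<Rightarrow> ('i \<Rightarrow> 'a) \<Rightarrow> 'a \<Rightarrow> 'i set" where
  "right_descents W I s w =
    {i \<in> I. coxeter_length W I s (w \<otimes>\<^bsub>W\<^esub> s i) < coxeter_length W I s w}"


section \<open>The biHecke monoid\<close>

text \<open>
  Functions \<open>A \<Rightarrow> A\<close> are represented by their extensional versions, so that equality of elements
  means equality on \<open>A\<close>. They act on the right: the product \<open>f g\<close> is ``first \<open>f\<close>, then \<open>g\<close>''.
\<close>

definition right_transformation_monoid :: "'a set \<Rightarrow> ('a \<Rightarrow> 'a) monoid" where
  "right_transformation_monoid A =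
    \<lparr>carrier = A \<rightarrow>\<^sub>E A, mult = (\<lambda>f g. compose A g f), one = (\<lambda>x\<in>A. x)\<rparr>"

inductive_set generated_submonoid :: "('a, 'b) monoid_scheme \<Rightarrow> 'a set \<Rightarrow> 'a set"
  for G :: "('a, 'b) monoid_scheme" and H :: "'a set" where
  one: "\<one>\<^bsub>G\<^esub> \<in> generated_submonoid G H"
| incl: "h \<in> H \<Longrightarrow> h \<in> generated_submonoid G H"
| mult: "f \<in> generated_submonoid G H \<Longrightarrow> g \<in> generated_submonoid G H
    \<Longrightarrow> f \<otimes>\<^bsub>G\<^esub> g \<in> generated_submonoid G H"

definition hecke_pi :: "('a, 'b) monoid_scheme \<Rightarrow> 'i set \<Rightarrow> ('i \<Rightarrow> 'a) \<Rightarrow> 'i \<Rightarrow> 'a \<Rightarrow> 'a" where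
  "hecke_pi W I s i =
    (\<lambda>w\<in>carrier W. if i \<in> right_descents W I s w then w else w \<otimes>\<^bsub>W\<^esub> s i)"

definition hecke_pi_bar :: "('a, 'b) monoid_scheme \<Rightarrow> 'i set \<Rightarrow> ('i \<Rightarrow> 'a) \<Rightarrow> 'i \<Rightarrow> 'a \<Rightarrow> 'a" where
  "hecke_pi_bar W I s i =
    (\<lambda>w\<in>carrier W. if i \<in> right_descents W I s w then w \<otimes>\<^bsub>W\<^esub> s i else w)"

definition biHecke_monoid ::
  "('a, 'b) monoid_scheme \<Rightarrow> 'i set \<Rightarrow> ('i \<Rightarrow> 'a) \<Rightarrow> ('a \<Rightarrow> 'a) monoid" where
  "biHecke_monoid W I s =
    (right_transformation_monoid (carrier W))
      \<lparr>carrier := generated_submonoid (right_transformation_monoid (carrier W))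
         (hecke_pi W I s ` I \<union> hecke_pi_bar W I s ` I)\<rparr>"

lemma monoid_right_transformation_monoid: "monoid (right_transformation_monoid A)"
  by (rule monoidI)
    (auto simp: right_transformation_monoid_def compose_def extensional_def PiE_iff
      intro!: ext split: if_splits)

lemma submonoid_generated_submonoid:
  assumes "monoid G" "H \<subseteq> carrier G"
  shows "submonoid (generated_submonoid G H) G"
proof -
  interpret monoid G by fact
  have "x \<in> carrier G" if "x \<in> generated_submonoid G H" for x
    using that assms(2) by induction auto
  then show ?thesis
    by (auto intro!: submonoid.intro intro: generated_submonoid.intros)
qed

lemma (in coxeter_system) monoid_biHecke_monoid: "monoid (biHecke_monoid W I s)"
  unfolding biHecke_monoid_def
  by (intro submonoid.submonoid_is_monoid submonoid_generated_submonoid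
      monoid_right_transformation_monoid)
    (auto simp: right_transformation_monoid_def hecke_pi_def hecke_pi_bar_def simple_closed)

end

theory Submission
  imports Defs
begin

text \<open>
  Aperiodicity comes from the rigidity of the action on the left weak order, the order on \<open>W\<close>
  whose covers are the edges \<open>w \<longrightarrow> s\<^sub>i w\<close> with \<open>\<ell>(s\<^sub>i w) > \<ell>(w)\<close>. Every element of
  \<open>M(W)\<close> sends such an edge either to a single point or to an edge that carries the same label
  \<open>i\<close> (\<open>label_preserving_biHecke\<close>). For a generator \<open>\<pi>\<^sub>j\<close> or its barred
  counterpart this is a matter of comparing the right descents of \<open>w\<close> and \<open>s\<^sub>i w\<close>: left and right multiplication commute, so the two images could only fall out of step
  if \<open>j\<close> is a descent of \<open>s\<^sub>i w\<close> but not of \<open>w\<close>, and then the exchange condition forces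
  \<open>s\<^sub>i w = w s\<^sub>j\<close> (\<open>exchange\<close>), so that the edge is contracted. The property is
  closed under composition.

  Now let \<open>f\<close> have this property. Under a power of \<open>f\<close>, a path from \<open>1\<close> up to \<open>u\<close> becomes a path that only stays or
  ascends, hence \<open>u.f\<^sup>n\<close> equals \<open>1.f\<^sup>n\<close> or is longer. For \<open>u = 1.f\<close> this says that the orbit of
  \<open>1\<close> under \<open>f\<close> grows in length until it reaches a fixed point, and it must reach one because \<open>W\<close> is finite.
  Fixed points then propagate along the edges: once the orbit of \<open>v\<close> has arrived at a
  fixed point \<open>z\<close>, the orbit of \<open>s\<^sub>i v\<close> can only move from \<open>s\<^sub>i z\<close> to \<open>z\<close>, because the label
  \<open>i\<close> cannot change. So every orbit ends in a fixed point, and a common exponent exists by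
  finiteness.

  The exchange condition is derived from the presentation of \<open>W\<close> through the inversions of
  words: the parity with which a given element of \<open>W\<close> occurs as an inversion is
  compatible with the Coxeter relations, hence depends on the group element only.
\<close>

section \<open>Words and lengths\<close>

context coxeter_system
begin

abbreviation wd :: "'i list \<Rightarrow> 'a" where
  "wd \<equiv> word_prod W s"

abbreviation len :: "'a \<Rightarrow> nat" where
  "len \<equiv> coxeter_length W I s"

lemma wd_closed [simp]: "u \<in> lists I \<Longrightarrow> wd u \<in> carrier W"
  by (induction u) (auto simp: simple_closed)

lemma wd_append:
  "u \<in> lists I \<Longrightarrow> v \<in> lists I \<Longrightarrow> wd (u @ v) = wd u \<otimes> wd v"
  by (induction u) (auto simp: simple_closed m_assoc)

lemma simple_involution [simp]: "i \<in> I \<Longrightarrow> s i \<otimes> s i = \<one>"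
  using coxeter_equiv.relation[of "[]" I "[]" i i m] presented[of "[i, i]" "[]"]
  by (simp add: matrix_diag simple_closed)

lemma simple_cancel_left [simp]:
  "i \<in> I \<Longrightarrow> x \<in> carrier W \<Longrightarrow> s i \<otimes> (s i \<otimes> x) = x"
  by (simp add: m_assoc[symmetric] simple_closed)

lemma simple_cancel_right [simp]:
  "i \<in> I \<Longrightarrow> x \<in> carrier W \<Longrightarrow> x \<otimes> s i \<otimes> s i = x"
  by (simp add: m_assoc simple_closed)

lemma inv_simple [simp]: "i \<in> I \<Longrightarrow> inv (s i) = s i"
  by (rule inv_equality) (auto simp: simple_closed)

lemma obtain_reduced_word:
  assumes "w \<in> carrier W"
  obtains u where "u \<in> lists I" "wd u = w" "length u = len w"
proof -
  obtain v where "v \<in> lists I" "wd v = w"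
    using generated[OF assms] by blast
  then have "\<exists>n. \<exists>u \<in> lists I. length u = n \<and> wd u = w"
    by blast
  from LeastI_ex[OF this] show ?thesis
    unfolding coxeter_length_def[symmetric] using that by blast
qed

lemma length_wd_le: "u \<in> lists I \<Longrightarrow> len (wd u) \<le> length u"
  unfolding coxeter_length_def by (rule Least_le) blast

lemma length_mult_simple_le:
  assumes "w \<in> carrier W" "i \<in> I"
  shows "len (w \<otimes> s i) \<le> Suc (len w)"
proof -
  obtain u where "u \<in> lists I" "wd u = w" "length u = len w"
    using obtain_reduced_word[OF assms(1)] .
  with assms length_wd_le[of "u @ [i]"] show ?thesis
    by (simp add: wd_append simple_closed)
qed

lemma length_simple_mult_le:
  assumes "w \<in> carrier W" "i \<in> I"
  shows "len (s i \<otimes> w) \<le> Suc (len w)"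
proof -
  obtain u where "u \<in> lists I" "wd u = w" "length u = len w"
    using obtain_reduced_word[OF assms(1)] .
  with assms length_wd_le[of "i # u"] show ?thesis
    by simp
qed

lemma length_le_mult_simple:
  assumes "w \<in> carrier W" "i \<in> I"
  shows "len w \<le> Suc (len (w \<otimes> s i))"
  using length_mult_simple_le[of "w \<otimes> s i" i] assms by (simp add: simple_closed)

text \<open>
  Induction upwards along the edges of the left weak order: reading a reduced word from its
  right end climbs from \<open>1\<close> to \<open>w\<close>.
\<close>

lemma left_weak_induct [consumes 1, case_names one step]:
  assumes "w \<in> carrier W"
    and one: "P \<one>"
    and step: "\<And>i w. i \<in> I \<Longrightarrow> w \<in> carrier W \<Longrightarrow> len w < len (s i \<otimes> w) \<Longrightarrow> P w \<Longrightarrow> P (s i \<otimes> w)"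
  shows "P w"
  using assms(1)
proof (induction "len w" arbitrary: w rule: less_induct)
  case less
  obtain u where u: "u \<in> lists I" "wd u = w" "length u = len w"
    using obtain_reduced_word[OF less.prems] .
  show ?case
  proof (cases u)
    case Nil
    with u one show ?thesis by simp
  next
    case (Cons i v)
    with u have "len (wd v) < len w" "v \<in> lists I" "i \<in> I" "w = s i \<otimes> wd v"
      using length_wd_le[of v] by auto
    with less.hyps[of "wd v"] step[of i "wd v"] show ?thesis
      by simp
  qed
qed


section \<open>Inversions and the exchange condition\<close>

text \<open>
  The inversions of a word \<open>i\<^sub>1 \<dots> i\<^sub>n\<close> are the elements
  \<open>s\<^bsub>i\<^sub>1\<^esub> \<dots> s\<^bsub>i\<^sub>k\<^esub> \<dots> s\<^bsub>i\<^sub>1\<^esub>\<close> for \<open>k = 1, \<dots>, n\<close>. The predicate holds if \<open>t\<close>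
  occurs an odd number of times among them; unlike the multiplicity, the parity is an invariant of the
  group element.
\<close>

fun inverts :: "'i list \<Rightarrow> 'a \<Rightarrow> bool" where
  "inverts [] t \<longleftrightarrow> False"
| "inverts (i # u) t \<longleftrightarrow> (t = s i) \<noteq> inverts u (s i \<otimes> t \<otimes> s i)"

lemma inverts_append:
  assumes "u \<in> lists I" "v \<in> lists I" "t \<in> carrier W"
  shows "inverts (u @ v) t \<longleftrightarrow> inverts u t \<noteq> inverts v (inv (wd u) \<otimes> t \<otimes> wd u)"
  using assms
  by (induction u arbitrary: t) (auto simp: simple_closed inv_mult_group m_assoc)

text \<open>
  Put \<open>c = s\<^sub>i s\<^sub>j\<close>. The inversions of \<open>(i j)\<^sup>n\<close> are \<open>c\<^sup>k s\<^sub>i\<close> for \<open>k < 2 n\<close>, since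
  conjugating \<open>c\<^sup>k s\<^sub>i\<close> by \<open>c\<close> gives \<open>c\<^bsup>k + 2\<^esup> s\<^sub>i\<close>.
\<close>

lemma inverts_alternating:
  assumes "i \<in> I" "j \<in> I" "t \<in> carrier W"
  shows "inverts (concat (replicate n [i, j])) t \<longleftrightarrow>
    odd (\<Sum>k<2 * n. of_bool (t = (s i \<otimes> s j) [^] k \<otimes> s i) :: nat)"
  using assms(3)
proof (induction n arbitrary: t)
  case 0
  then show ?case by simp
next
  case (Suc n)
  define c where "c = s i \<otimes> s j"
  note [simp] = simple_closed[OF assms(1)] simple_closed[OF assms(2)]
  have c [simp]: "c \<in> carrier W"
    by (simp add: c_def)
  have inv_c: "inv c = s j \<otimes> s i"
    using assms by (simp add: c_def inv_mult_group)
  have shift: "inv c \<otimes> t \<otimes> c = c [^] k \<otimes> s i \<longleftrightarrow> t = c [^] Suc (Suc k) \<otimes> s i" for k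
  proof -
    have "c \<otimes> (c [^] k \<otimes> s i) \<otimes> inv c = c \<otimes> c [^] k \<otimes> c \<otimes> s i"
      unfolding inv_c using assms by (simp add: c_def m_assoc)
    also have "\<dots> = c [^] Suc (Suc k) \<otimes> s i"
      using nat_pow_Suc2[OF c, of k] by simp
    finally have *: "c \<otimes> (c [^] k \<otimes> s i) \<otimes> inv c = c [^] Suc (Suc k) \<otimes> s i" .
    have "inv c \<otimes> t \<otimes> c = c [^] k \<otimes> s i \<longleftrightarrow> t \<otimes> c = c \<otimes> (c [^] k \<otimes> s i)"
      using Suc.prems by (simp add: inv_solve_left' m_assoc)
    also have "\<dots> \<longleftrightarrow> t = c \<otimes> (c [^] k \<otimes> s i) \<otimes> inv c"
      using Suc.prems by (auto simp: inv_solve_right)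
    finally show ?thesis
      using * by simp
  qed
  have second: "s i \<otimes> t \<otimes> s i = s j \<longleftrightarrow> t = c \<otimes> s i"
  proof
    assume "s i \<otimes> t \<otimes> s i = s j"
    moreover have "t = s i \<otimes> (s i \<otimes> t \<otimes> s i) \<otimes> s i"
      using Suc.prems assms by (simp add: m_assoc)
    ultimately show "t = c \<otimes> s i"
      by (simp add: c_def)
  next
    assume "t = c \<otimes> s i"
    then show "s i \<otimes> t \<otimes> s i = s j"
      using assms by (simp add: c_def m_assoc)
  qed
  have conj: "s j \<otimes> (s i \<otimes> t \<otimes> s i) \<otimes> s j = inv c \<otimes> t \<otimes> c"
    unfolding inv_c using Suc.prems by (simp add: c_def m_assoc)
  have "inverts (concat (replicate (Suc n) [i, j])) t \<longleftrightarrow>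
    ((t = s i) \<noteq> ((t = c \<otimes> s i) \<noteq> inverts (concat (replicate n [i, j])) (inv c \<otimes> t \<otimes> c)))"
    using second conj by simp
  also have "inverts (concat (replicate n [i, j])) (inv c \<otimes> t \<otimes> c) \<longleftrightarrow>
    odd (\<Sum>k<2 * n. of_bool (t = c [^] Suc (Suc k) \<otimes> s i) :: nat)"
    using Suc.IH[of "inv c \<otimes> t \<otimes> c"] Suc.prems shift unfolding c_def[symmetric] by simp
  finally show ?case
    unfolding c_def[symmetric] by (simp add: sum.lessThan_Suc_shift del: sum.lessThan_Suc)
qed

text \<open>
  A Coxeter relation has no inversions modulo 2: \<open>(s\<^sub>i s\<^sub>j)\<^sup>m = 1\<close> makes the list of its \<open>2 m\<close> inversions
  periodic with period \<open>m\<close>.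
\<close>

lemma not_inverts_relation:
  assumes "i \<in> I" "j \<in> I" "m i j > 0" "t \<in> carrier W"
  shows "\<not> inverts (concat (replicate (m i j) [i, j])) t"
proof -
  define c where "c = s i \<otimes> s j"
  define g :: "nat \<Rightarrow> nat" where "g k = of_bool (t = c [^] k \<otimes> s i)" for k
  have c [simp]: "c \<in> carrier W"
    by (simp add: c_def simple_closed assms)
  have "wd (concat (replicate n [i, j])) = c [^] n" for n
  proof (induction n)
    case (Suc n)
    then show ?case
      using assms nat_pow_Suc2[OF c, of n] by (simp add: c_def m_assoc simple_closed)
  qed simp
  moreover have "wd (concat (replicate (m i j) [i, j])) = wd []"
    using coxeter_equiv.relation[of "[]" I "[]" i j m] assms
    by (subst presented) auto
  ultimately have "c [^] m i j = \<one>"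
    by simp
  then have "g (k + m i j) = g k" for k
    by (simp add: g_def nat_pow_mult[symmetric])
  then have "(\<Sum>k<n + m i j. g k) = (\<Sum>k<n. g k) + (\<Sum>k<m i j. g k)" for n
    by (induction n) (simp_all add: add_ac)
  then have "even (\<Sum>k<m i j + m i j. g k)"
    by simp
  then show ?thesis
    unfolding inverts_alternating[OF assms(1,2,4)] c_def[symmetric] g_def[symmetric]
    by (simp add: mult_2)
qed

lemma inverts_coxeter_equiv:
  assumes "coxeter_equiv I m u v" "t \<in> carrier W"
  shows "inverts u t \<longleftrightarrow> inverts v t"
  using assms
proof (induction arbitrary: t)
  case (relation p q i j)
  let ?r = "concat (replicate (m i j) [i, j])"
  have r: "?r \<in> lists I"
    using relation.hyps by auto
  have "wd (?r @ q) = wd q"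
    using coxeter_equiv.relation[of "[]" I q i j m] relation.hyps r
    by (subst presented) auto
  then have "wd ?r = \<one>"
    using relation.hyps r by (simp add: wd_append)
  then show ?case
    using relation r not_inverts_relation by (simp add: inverts_append)
qed auto

text \<open>
  If \<open>t\<close> is the \<open>k\<close>-th inversion of a word, then multiplying by \<open>t\<close> on the left deletes its
  \<open>k\<close>-th letter.
\<close>

lemma inverts_imp_shorter:
  assumes "u \<in> lists I" "t \<in> carrier W" "inverts u t"
  shows "\<exists>v \<in> lists I. length v < length u \<and> wd v = t \<otimes> wd u"
  using assms
proof (induction u arbitrary: t)
  case Nil
  then show ?case by simp
next
  case (Cons i u)
  then have i: "i \<in> I" "u \<in> lists I" "s i \<in> carrier W"
    by (auto simp: simple_closed)
  show ?case
  proof (cases "t = s i")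
    case True
    with i show ?thesis
      by (intro bexI[of _ u]) auto
  next
    case False
    with Cons.prems have "inverts u (s i \<otimes> t \<otimes> s i)"
      by simp
    with Cons.IH i Cons.prems obtain v where "v \<in> lists I" "length v < length u"
      "wd v = s i \<otimes> t \<otimes> s i \<otimes> wd u"
      by (meson m_closed)
    with Cons i show ?thesis
      by (intro bexI[of _ "i # v"]) (auto simp: m_assoc)
  qed
qed

lemma inverts_imp_length_less:
  assumes "u \<in> lists I" "t \<in> carrier W" "inverts u t"
  shows "len (t \<otimes> wd u) < len (wd u)"
proof -
  obtain v where v: "v \<in> lists I" "wd v = wd u" "length v = len (wd u)"
    using obtain_reduced_word[of "wd u"] assms(1) by auto
  then have "inverts v t"
    using assms presented[of u v] inverts_coxeter_equiv[of u v t] by simp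
  then show ?thesis
    using inverts_imp_shorter[of v t] v assms(2) length_wd_le by fastforce
qed

text \<open>
  The words \<open>u\<close> and \<open>u i\<close> differ in the single inversion \<open>t\<close> below, and \<open>t \<cdot> u = u i\<close>.
  So \<open>t\<close> is an inversion of exactly one of them, and this one is the longer element.
\<close>

lemma length_mult_simple_cases:
  assumes "u \<in> lists I" "i \<in> I"
  defines "t \<equiv> wd u \<otimes> s i \<otimes> inv (wd u)"
  shows "if inverts u t then len (wd u \<otimes> s i) < len (wd u) else len (wd u) < len (wd u \<otimes> s i)"
proof -
  note [simp] = simple_closed[OF assms(2)]
  have t: "t \<in> carrier W" "t \<otimes> wd u = wd u \<otimes> s i"
    using assms by (simp_all add: m_assoc)
  have "inv (wd u) \<otimes> t \<otimes> wd u = s i"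
    using assms t by (simp add: m_assoc) (simp add: m_assoc[symmetric])
  then have "inverts (u @ [i]) t \<longleftrightarrow> \<not> inverts u t"
    using assms t by (simp add: inverts_append)
  moreover have "t \<otimes> wd (u @ [i]) = wd u"
    using assms t by (simp add: wd_append m_assoc[symmetric])
  ultimately show ?thesis
    using inverts_imp_length_less[of u t] inverts_imp_length_less[of "u @ [i]" t] assms t
    by (auto simp: wd_append)
qed

lemma not_descent_imp_length_less:
  assumes "w \<in> carrier W" "i \<in> I" "i \<notin> right_descents W I s w"
  shows "len w < len (w \<otimes> s i)"
proof -
  obtain u where "u \<in> lists I" "wd u = w"
    using generated[OF assms(1)] by blast
  with assms length_mult_simple_cases[of u i] show ?thesis
    by (auto simp: right_descents_def split: if_splits)
qed

text \<open>
  If \<open>j\<close> becomes a descent by multiplication with \<open>s\<^sub>i\<close>, then the inversion of \<open>s\<^sub>i w\<close>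
  responsible for it is not inherited from \<open>w\<close>, so it is \<open>s\<^sub>i\<close> itself.
\<close>

lemma exchange:
  assumes w: "w \<in> carrier W" and i: "i \<in> I" and j: "j \<in> I"
    and "j \<notin> right_descents W I s w" "j \<in> right_descents W I s (s i \<otimes> w)"
  shows "s i \<otimes> w = w \<otimes> s j"
proof -
  note [simp] = simple_closed[OF i] simple_closed[OF j] w
  obtain u where u: "u \<in> lists I" "wd u = w"
    using generated[OF w] by blast
  define t where "t = s i \<otimes> w \<otimes> s j \<otimes> inv (s i \<otimes> w)"
  have t: "t \<in> carrier W" "s i \<otimes> t \<otimes> s i = w \<otimes> s j \<otimes> inv w"
    using i by (simp_all add: t_def inv_mult_group m_assoc)
  have "\<not> inverts u (s i \<otimes> t \<otimes> s i)"
    using length_mult_simple_cases[OF u(1) j] assms u(2) t(2)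
    by (auto simp: right_descents_def split: if_splits)
  moreover have "inverts (i # u) t"
    using length_mult_simple_cases[of "i # u" j] assms u
    by (auto simp: right_descents_def t_def split: if_splits)
  ultimately have "t = s i"
    by simp
  have "s i \<otimes> w \<otimes> s j = t \<otimes> (s i \<otimes> w)"
    unfolding t_def by (simp add: m_assoc)
  then have "s i \<otimes> (w \<otimes> s j) = w"
    using \<open>t = s i\<close> i by (simp add: m_assoc)
  then show ?thesis
    using i by (metis simple_cancel_left m_closed simple_closed j w)
qed


section \<open>The action on the left weak order\<close>

text \<open>
  The image of an edge with label \<open>i\<close> is required to be directed upwards again: this orientation is
  what makes lengths grow along orbits.
\<close>

definition label_preserving :: "('a \<Rightarrow> 'a) \<Rightarrow> bool" where
  "label_preserving f \<longleftrightarrow> f \<in> carrier W \<rightarrow> carrier W \<and>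
    (\<forall>i \<in> I. \<forall>w \<in> carrier W. len w < len (s i \<otimes> w) \<longrightarrow>
      f (s i \<otimes> w) = f w \<or> f (s i \<otimes> w) = s i \<otimes> f w \<and> len (f w) < len (s i \<otimes> f w))"

lemma label_preserving_closed:
  "label_preserving f \<Longrightarrow> w \<in> carrier W \<Longrightarrow> f w \<in> carrier W"
  by (auto simp: label_preserving_def)

lemma label_preserving_cases:
  assumes "label_preserving f" "i \<in> I" "w \<in> carrier W" "len w < len (s i \<otimes> w)"
  obtains (contract) "f (s i \<otimes> w) = f w"
    | (keep) "f (s i \<otimes> w) = s i \<otimes> f w" "len (f w) < len (s i \<otimes> f w)"
  using assms unfolding label_preserving_def by blast

lemma label_preserving_comp:
  assumes f: "label_preserving f" and g: "label_preserving g"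
  shows "label_preserving (g \<circ> f)"
  unfolding label_preserving_def
proof (intro conjI ballI impI)
  show "g \<circ> f \<in> carrier W \<rightarrow> carrier W"
    using f g by (auto simp: label_preserving_def)
  fix i w
  assume *: "i \<in> I" "w \<in> carrier W" "len w < len (s i \<otimes> w)"
  show "(g \<circ> f) (s i \<otimes> w) = (g \<circ> f) w \<or>
    (g \<circ> f) (s i \<otimes> w) = s i \<otimes> (g \<circ> f) w \<and> len ((g \<circ> f) w) < len (s i \<otimes> (g \<circ> f) w)"
  proof (cases rule: label_preserving_cases[OF f *])
    case keep: 2
    show ?thesis
      by (cases rule: label_preserving_cases[OF g *(1) label_preserving_closed[OF f *(2)] keep(2)])
        (simp_all add: keep(1))
  qed simp
qed

lemma label_preserving_funpow: "label_preserving f \<Longrightarrow> label_preserving (f ^^ n)"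
proof (induction n)
  case 0
  then show ?case by (simp add: label_preserving_def)
next
  case (Suc n)
  then show ?case using label_preserving_comp[of "f ^^ n" f] by (simp add: comp_def)
qed

lemma label_preserving_cong:
  assumes "label_preserving f" "\<And>w. w \<in> carrier W \<Longrightarrow> g w = f w"
  shows "label_preserving g"
  using assms unfolding label_preserving_def by (simp add: simple_closed Pi_iff)

text \<open>
  A descent of \<open>w\<close> stays a descent along an edge \<open>w \<longrightarrow> s\<^sub>i w\<close>; where the descents agree, both
  ends are moved by the same right multiplication. The remaining case is \<open>exchange\<close>.
\<close>

lemma edge_descent_cases:
  assumes w: "w \<in> carrier W" and i: "i \<in> I" and j: "j \<in> I" and up: "len w < len (s i \<otimes> w)"
  obtains
    (agree) "j \<in> right_descents W I s (s i \<otimes> w) \<longleftrightarrow> j \<in> right_descents W I s w"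
      "len (w \<otimes> s j) < len (s i \<otimes> (w \<otimes> s j))"
  | (swap) "j \<notin> right_descents W I s w" "j \<in> right_descents W I s (s i \<otimes> w)"
      "s i \<otimes> w = w \<otimes> s j"
proof -
  note [simp] = simple_closed[OF i] simple_closed[OF j] w
  have assoc: "s i \<otimes> w \<otimes> s j = s i \<otimes> (w \<otimes> s j)"
    by (simp add: m_assoc)
  show ?thesis
  proof (cases "j \<in> right_descents W I s w")
    case True
    then have down: "len (w \<otimes> s j) < len w"
      by (simp add: right_descents_def)
    then have "j \<in> right_descents W I s (s i \<otimes> w)"
      using length_simple_mult_le[of "w \<otimes> s j" i] up i j
      by (simp add: right_descents_def assoc)
    moreover have "len (w \<otimes> s j) < len (s i \<otimes> (w \<otimes> s j))"
      using length_le_mult_simple[of "s i \<otimes> w" j] down up j by (simp add: assoc)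
    ultimately show ?thesis
      using True agree by blast
  next
    case False
    show ?thesis
    proof (cases "j \<in> right_descents W I s (s i \<otimes> w)")
      case True
      with False exchange[OF w i j] swap show ?thesis
        by blast
    next
      case no_descent: False
      have "len (w \<otimes> s j) < len (s i \<otimes> (w \<otimes> s j))"
        using not_descent_imp_length_less[OF _ j no_descent] length_mult_simple_le[OF w j] up
        by (simp add: assoc)
      with no_descent False agree show ?thesis by blast
    qed
  qed
qed

lemma label_preserving_hecke_pi: "j \<in> I \<Longrightarrow> label_preserving (hecke_pi W I s j)"
  unfolding label_preserving_def
proof (intro conjI ballI impI)
  assume j: "j \<in> I"
  show "hecke_pi W I s j \<in> carrier W \<rightarrow> carrier W"
    using j by (simp add: hecke_pi_def simple_closed)
  fix i w
  assume *: "i \<in> I" "w \<in> carrier W" "len w < len (s i \<otimes> w)"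
  show "hecke_pi W I s j (s i \<otimes> w) = hecke_pi W I s j w \<or>
    hecke_pi W I s j (s i \<otimes> w) = s i \<otimes> hecke_pi W I s j w \<and>
    len (hecke_pi W I s j w) < len (s i \<otimes> hecke_pi W I s j w)"
    using * j
    by (cases rule: edge_descent_cases[OF *(2,1) j *(3)])
      (simp_all add: hecke_pi_def simple_closed m_assoc)
qed

lemma label_preserving_hecke_pi_bar: "j \<in> I \<Longrightarrow> label_preserving (hecke_pi_bar W I s j)"
  unfolding label_preserving_def
proof (intro conjI ballI impI)
  assume j: "j \<in> I"
  show "hecke_pi_bar W I s j \<in> carrier W \<rightarrow> carrier W"
    using j by (simp add: hecke_pi_bar_def simple_closed)
  fix i w
  assume *: "i \<in> I" "w \<in> carrier W" "len w < len (s i \<otimes> w)"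
  show "hecke_pi_bar W I s j (s i \<otimes> w) = hecke_pi_bar W I s j w \<or>
    hecke_pi_bar W I s j (s i \<otimes> w) = s i \<otimes> hecke_pi_bar W I s j w \<and>
    len (hecke_pi_bar W I s j w) < len (s i \<otimes> hecke_pi_bar W I s j w)"
    using * j
    by (cases rule: edge_descent_cases[OF *(2,1) j *(3)])
      (simp_all add: hecke_pi_bar_def simple_closed m_assoc)
qed

lemma label_preserving_biHecke:
  assumes "f \<in> carrier (biHecke_monoid W I s)"
  shows "label_preserving f"
proof -
  let ?T = "right_transformation_monoid (carrier W)"
  have "f \<in> generated_submonoid ?T (hecke_pi W I s ` I \<union> hecke_pi_bar W I s ` I)"
    using assms by (simp add: biHecke_monoid_def)
  then show ?thesis
  proof induction
    case one
    then show ?case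
      by (simp add: right_transformation_monoid_def label_preserving_def simple_closed)
  next
    case (incl h)
    then show ?case
      using label_preserving_hecke_pi label_preserving_hecke_pi_bar by auto
  next
    case (mult f g)
    show ?case
      by (rule label_preserving_cong[OF label_preserving_comp[OF mult.IH]])
        (simp add: right_transformation_monoid_def compose_def)
  qed
qed


section \<open>Orbits end in fixed points\<close>

text \<open>
  A path of edges from \<open>1\<close> to \<open>w\<close> is mapped to a path from \<open>f 1\<close> to \<open>f w\<close> whose steps stay or ascend.
\<close>

lemma label_preserving_image_one:
  assumes "label_preserving f" "w \<in> carrier W"
  shows "f w = f \<one> \<or> len (f \<one>) < len (f w)"
  using assms(2)
proof (induction rule: left_weak_induct)
  case one
  then show ?case by simp
next
  case (step i w)
  then show ?case
    by (cases rule: label_preserving_cases[OF assms(1) step(1-3)]) auto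
qed

lemma orbit_one_reaches_fixed_point:
  assumes f: "label_preserving f" and "finite (carrier W)"
  shows "\<exists>k. f ((f ^^ k) \<one>) = (f ^^ k) \<one>"
proof (rule ccontr)
  assume no_fixed: "\<not> ?thesis"
  have closed: "(f ^^ n) \<one> \<in> carrier W" for n
    using label_preserving_closed[OF label_preserving_funpow[OF f]] by simp
  have "len ((f ^^ n) \<one>) < len ((f ^^ Suc n) \<one>)" for n
  proof -
    \<comment> \<open>Here \<open>1.f\<^bsup>n+1\<^esup>\<close> is regarded as the image of \<open>1.f\<close> under \<open>f\<^sup>n\<close>.\<close>
    have "(f ^^ n) (f \<one>) \<noteq> (f ^^ n) \<one>"
      using no_fixed by (metis funpow_swap1)
    then show ?thesis
      using label_preserving_image_one[OF label_preserving_funpow[OF f], of "f \<one>" n]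
        label_preserving_closed[OF f]
      by (simp add: funpow_swap1)
  qed
  then have mono: "strict_mono (\<lambda>n. len ((f ^^ n) \<one>))"
    by (simp add: strict_mono_Suc_iff)
  have "inj (\<lambda>n. (f ^^ n) \<one>)"
    by (rule injI, subst strict_mono_eq[OF mono, symmetric]) simp
  then show False
    using closed assms(2) by (meson finite_imageD finite_subset image_subsetI infinite_UNIV_nat)
qed

text \<open>
  When the orbit of \<open>w\<close> rests at \<open>z\<close>, the orbit of \<open>s\<^sub>i w\<close> is at \<open>z\<close> or at \<open>s\<^sub>i z\<close>. In the
  latter case the edge \<open>z \<longrightarrow> s\<^sub>i z\<close>, whose lower end is fixed, is either fixed too or contracted to
  \<open>z\<close>.
\<close>

lemma orbit_reaches_fixed_point:
  assumes f: "label_preserving f" and "finite (carrier W)" and "w \<in> carrier W"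
  shows "\<exists>k. f ((f ^^ k) w) = (f ^^ k) w"
  using assms(3)
proof (induction rule: left_weak_induct)
  case one
  show ?case
    using orbit_one_reaches_fixed_point[OF assms(1,2)] .
next
  case (step i w)
  then obtain k where k: "f ((f ^^ k) w) = (f ^^ k) w"
    by blast
  define z where "z = (f ^^ k) w"
  have z: "z \<in> carrier W" "f z = z"
    using k label_preserving_closed[OF label_preserving_funpow[OF f] step(2)]
    by (simp_all add: z_def)
  show ?case
  proof (cases rule: label_preserving_cases[OF label_preserving_funpow[OF f, of k] step(1-3)])
    case contract: 1
    with k show ?thesis by metis
  next
    case keep: 2
    then have keep': "(f ^^ k) (s i \<otimes> w) = s i \<otimes> z" "len z < len (s i \<otimes> z)"
      by (simp_all add: z_def)
    show ?thesis
    proof (cases rule: label_preserving_cases[OF f step(1) z(1) keep'(2)])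
      case contract: 1
      then have "f ((f ^^ Suc k) (s i \<otimes> w)) = (f ^^ Suc k) (s i \<otimes> w)"
        using keep'(1) z(2) by simp
      then show ?thesis by blast
    next
      case keep: 2
      then have "f ((f ^^ k) (s i \<otimes> w)) = (f ^^ k) (s i \<otimes> w)"
        using keep'(1) z(2) by simp
      then show ?thesis by blast
    qed
  qed
qed

lemma biHecke_pow:
  assumes "f \<in> carrier (biHecke_monoid W I s)"
  shows "f [^]\<^bsub>biHecke_monoid W I s\<^esub> (n::nat) = restrict (f ^^ n) (carrier W)"
proof (induction n)
  case 0
  show ?case
    by (simp add: biHecke_monoid_def right_transformation_monoid_def nat_pow_def restrict_def)
next
  case (Suc n)
  have "f [^]\<^bsub>biHecke_monoid W I s\<^esub> Suc n
      = compose (carrier W) f (f [^]\<^bsub>biHecke_monoid W I s\<^esub> n)"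
    by (simp add: biHecke_monoid_def right_transformation_monoid_def nat_pow_def)
  then show ?case
    by (auto simp: Suc compose_def)
qed

end

theorem proposition3p8:
  fixes W :: "('a, 'b) monoid_scheme"
    and I :: "'i set" and m :: "'i \<Rightarrow> 'i \<Rightarrow> nat" and s :: "'i \<Rightarrow> 'a"
  assumes "coxeter_system W I m s"
    and "finite (carrier W)"
  shows "\<forall>f \<in> carrier (biHecke_monoid W I s). \<exists>k::nat. k > 0 \<and>
    f [^]\<^bsub>biHecke_monoid W I s\<^esub> (k + 1) = f [^]\<^bsub>biHecke_monoid W I s\<^esub> k"
proof
  interpret coxeter_system W I m s by fact
  fix f
  assume f: "f \<in> carrier (biHecke_monoid W I s)"
  obtain \<kappa> where \<kappa>: "f ((f ^^ \<kappa> w) w) = (f ^^ \<kappa> w) w" if "w \<in> carrier W" for w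
    using orbit_reaches_fixed_point[OF label_preserving_biHecke[OF f] assms(2)] by metis
  define k where "k = Suc (Max (\<kappa> ` carrier W))"
  have "f ((f ^^ k) w) = (f ^^ k) w" if "w \<in> carrier W" for w
  proof -
    have fixed: "(f ^^ n) ((f ^^ \<kappa> w) w) = (f ^^ \<kappa> w) w" for n
      by (induction n) (simp_all add: \<kappa>[OF that])
    have "\<kappa> w \<le> k"
      using assms(2) that by (simp add: k_def le_SucI)
    then have "(f ^^ k) w = (f ^^ (k - \<kappa> w)) ((f ^^ \<kappa> w) w)"
      by (metis comp_apply funpow_add le_add_diff_inverse2)
    also have "\<dots> = (f ^^ \<kappa> w) w"
      by (rule fixed)
    finally show ?thesis
      using \<kappa>[OF that] by simp
  qed
  then have "f [^]\<^bsub>biHecke_monoid W I s\<^esub> (k + 1) = f [^]\<^bsub>biHecke_monoid W I s\<^esub> k"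
    unfolding biHecke_pow[OF f] by (auto simp: restrict_def)
  then show "\<exists>k::nat. k > 0 \<and>
    f [^]\<^bsub>biHecke_monoid W I s\<^esub> (k + 1) = f [^]\<^bsub>biHecke_monoid W I s\<^esub> k"
    unfolding k_def by blast
qed

end
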